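(* Let $G=(V,E)$ be an undirected graph with positive edge weights $w:E\to\mathbb R^+$, let $M^*$ be a maximum weight matching of $G$, and let $\alpha>1$. Choose $r$ uniformly at random from $(0,1]$. Put each edge $e$ in level $i$ (an integer) if $w(e)\in[\alpha^{i+r},\alpha^{i+r+1})$, let $E_i$ be the set of edges at level $i$, $G_i=(V,E_i)$, and let $M_i$ be a maximal matching of $G_i$ for each level $i$. Let $\mathcal H=(V,\bigcup_i M_i)$, and let $M_r$ be a matching contained in $E(\mathcal H)$ such that every edge $e\in E(\mathcal H)$ either belongs to $M_r$ or shares an endpoint with an edge $e'\in M_r$ whose level is strictly greater than the level of $e$ (this is the matching maintained by the algorithm with randomized scaling). Then $$E_r\Big[\sum_{e\in M_r}w(e)\Big]\ \ge\ \frac{(\alpha-1)^2}{2\alpha^2\ln\alpha}\,w(M^* ),$$ i.e. the expected approximation ratio is $\frac{2\alpha^2\ln\alpha}{(\alpha-1)^2}$. This ratio is minimized when $\alpha\approx 3.512$, where its value is $\approx 4.9108$.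
   Context: A matching is a set of edges no two sharing a vertex; $w(M)=\sum_{e\in M}w(e)$; a maximum weight matching is a matching of maximum total weight. A maximal matching of a graph is a matching to which no further edge of that graph can be added while remaining a matching. $\ln$ is the natural logarithm. The expectation is over the choice of $r$. *)

theory Defs
  imports "HOL-Probability.Probability"
begin

definition ugraph :: "'a set \<Rightarrow> 'a set set \<Rightarrow> bool" where
  "ugraph V E \<longleftrightarrow> finite V \<and> E \<subseteq> {e. e \<subseteq> V \<and> card e = 2}"

definition matching :: "'a set set \<Rightarrow> 'a set set \<Rightarrow> bool" where
  "matching E M \<longleftrightarrow> M \<subseteq> E \<and> (\<forall>e\<in>M. \<forall>e'\<in>M. e \<noteq> e' \<longrightarrow> e \<inter> e' = {})"

definition max_weight_matching :: "('a set \<Rightarrow> real) \<Rightarrow> 'a set set \<Rightarrow> 'a set set \<Rightarrow> bool" where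
  "max_weight_matching w E M \<longleftrightarrow> matching E M \<and> (\<forall>N. matching E N \<longrightarrow> sum w N \<le> sum w M)"

definition maximal_matching :: "'a set set \<Rightarrow> 'a set set \<Rightarrow> bool" where
  "maximal_matching E M \<longleftrightarrow> matching E M \<and> (\<forall>e\<in>E - M. \<not> matching E (insert e M))"

definition at_level :: "real \<Rightarrow> real \<Rightarrow> ('a set \<Rightarrow> real) \<Rightarrow> 'a set \<Rightarrow> int \<Rightarrow> bool" where
  "at_level \<alpha> r w e i \<longleftrightarrow> w e \<in> {\<alpha> powr (of_int i + r)..<\<alpha> powr (of_int i + r + 1)}"

definition level_edges :: "real \<Rightarrow> real \<Rightarrow> ('a set \<Rightarrow> real) \<Rightarrow> 'a set set \<Rightarrow> int \<Rightarrow> 'a set set" where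
  "level_edges \<alpha> r w E i = {e \<in> E. at_level \<alpha> r w e i}"

text \<open>
  For \<open>\<alpha> > 1\<close> and positive weights every edge is at exactly one level, so the levels
  \<open>i\<close> and \<open>j\<close> quantified here are the levels of \<open>e\<close> and \<open>e'\<close>.
\<close>
definition level_dominating_matching ::
  "real \<Rightarrow> real \<Rightarrow> ('a set \<Rightarrow> real) \<Rightarrow> 'a set set \<Rightarrow> 'a set set \<Rightarrow> bool" where
  "level_dominating_matching \<alpha> r w H M \<longleftrightarrow>
     matching H M \<and>
     (\<forall>e\<in>H. e \<in> M \<or>
        (\<exists>e'\<in>M. e \<inter> e' \<noteq> {} \<and> (\<exists>i j. at_level \<alpha> r w e i \<and> at_level \<alpha> r w e' j \<and> i < j)))"

definition scaling_ratio :: "real \<Rightarrow> real" where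
  "scaling_ratio \<alpha> = 2 * \<alpha>\<^sup>2 * ln \<alpha> / (\<alpha> - 1)\<^sup>2"

end

theory Submission
  imports Defs
begin

text \<open>
  Round every weight \<open>w e\<close> down to \<open>\<alpha> powr (i + r)\<close>, where \<open>i\<close> is the level of \<open>e\<close>. As the
  exponent is uniformly distributed on \<open>(log \<alpha> (w e) - 1, log \<alpha> (w e)]\<close>, the rounded weight has
  expectation \<open>(\<alpha> - 1) / (\<alpha> * ln \<alpha>) * w e\<close>, so it suffices to bound, for fixed \<open>r\<close>, the rounded
  weight of \<open>M\<^sup>*\<close> by \<open>2 * \<alpha> / (\<alpha> - 1)\<close> times that of \<open>M\<^sub>r\<close>.

  An edge \<open>e\<close> of \<open>M\<^sup>*\<close> meets some \<open>f\<close> in the maximal matching of its level, and \<open>f\<close> is in \<open>M\<^sub>r\<close> or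
  meets some \<open>g\<close> in \<open>M\<^sub>r\<close> of higher level; charge \<open>e\<close> to \<open>f\<close> or \<open>g\<close> respectively. At most two edges
  charged to \<open>g\<close> meet \<open>g\<close> itself. For every level below that of \<open>g\<close>, at most two edges \<open>f\<close> meet \<open>g\<close>,
  and each has only one endpoint off \<open>g\<close> through which it passes on a charge from an \<open>e\<close> disjoint
  from \<open>g\<close>. The geometric series over these levels gives \<open>2 + 2 / (\<alpha> - 1) = 2 * \<alpha> / (\<alpha> - 1)\<close>.

  The ratio decreases before and increases after the root \<open>a > 1\<close> of \<open>2 * ln a = a - 1\<close>, where it
  equals \<open>a\<^sup>2 / (a - 1)\<close>.
\<close>

section \<open>Charging argument for a fixed assignment of levels\<close>

text \<open>The bound reproduces itself when a new largest exponent b is added, since \<alpha>^b +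
  \<alpha>^b / (\<alpha> - 1) = \<alpha>^(b + 1) / (\<alpha> - 1) and b + 1 \<le> j. This avoids
  infinite series; gaps and negative exponents do no harm.\<close>

lemma sum_powr_below_le:
  fixes \<alpha> :: real and I :: "int set"
  assumes "\<alpha> > 1" "finite I" "\<And>i. i \<in> I \<Longrightarrow> i < j"
  shows "(\<Sum>i\<in>I. \<alpha> powr of_int i) \<le> \<alpha> powr of_int j / (\<alpha> - 1)"
  using assms(2,3)
proof (induction I arbitrary: j rule: finite_linorder_max_induct)
  case empty
  then show ?case using assms(1) by simp
next
  case (insert b I)
  have "(\<Sum>i\<in>insert b I. \<alpha> powr of_int i) = \<alpha> powr of_int b + (\<Sum>i\<in>I. \<alpha> powr of_int i)"
    using insert.hyps by (subst sum.insert) auto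
  also have "\<dots> \<le> \<alpha> powr of_int b + \<alpha> powr of_int b / (\<alpha> - 1)"
    using insert.hyps by (intro add_left_mono insert.IH) auto
  also have "\<dots> = \<alpha> powr (of_int b + 1) / (\<alpha> - 1)"
    using assms(1) by (simp add: powr_add field_simps)
  also have "\<dots> \<le> \<alpha> powr of_int j / (\<alpha> - 1)"
    using assms(1) insert.prems[of b] by (intro divide_right_mono powr_mono) auto
  finally show ?case .
qed

lemma maximal_matching_hits:
  assumes "maximal_matching E M" "e \<in> E" "e \<noteq> {}"
  obtains f where "f \<in> M" "e \<inter> f \<noteq> {}"
proof (cases "e \<in> M")
  case True
  then show ?thesis using that[of e] assms by auto
next
  case False
  then have "matching E M" "\<not> matching E (insert e M)"
    using assms by (auto simp: maximal_matching_def)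
  then have "\<exists>f\<in>M. e \<inter> f \<noteq> {}"
    using assms(2) unfolding matching_def by blast
  then show ?thesis using that by blast
qed

lemma level_charging:
  fixes \<alpha> :: real and lv :: "'a set \<Rightarrow> int"
  assumes alpha: "\<alpha> > 1"
    and E: "finite E" "\<And>e. e \<in> E \<Longrightarrow> card e = 2"
    and S: "matching E S"
    and L: "\<And>i. maximal_matching {e \<in> E. lv e = i} (L i)"
    and N: "matching (\<Union>i. L i) N"
    and dom: "\<And>f. f \<in> (\<Union>i. L i) \<Longrightarrow> f \<in> N \<or> (\<exists>g\<in>N. f \<inter> g \<noteq> {} \<and> lv f < lv g)"
  shows "(\<Sum>e\<in>S. \<alpha> powr of_int (lv e)) \<le> 2 * \<alpha> / (\<alpha> - 1) * (\<Sum>g\<in>N. \<alpha> powr of_int (lv g))"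
proof -
  \<comment> \<open>\<open>A g\<close> takes every edge of \<open>S\<close> that meets g and is not
    above its level; the case f = g forces \<le> rather than <. \<open>B g\<close> takes the edges
    disjoint from g that reach it through some f, and these lie strictly below g.\<close>
  define A where "A g = {e \<in> S. e \<inter> g \<noteq> {} \<and> lv e \<le> lv g}" for g
  define B where "B g = {e \<in> S. e \<inter> g = {} \<and> lv e < lv g \<and> (\<exists>f\<in>L (lv e). e \<inter> f \<noteq> {} \<and> f \<inter> g \<noteq> {})}" for g
  have LE: "f \<in> E" "lv f = i" if "f \<in> L i" for f i
    using L[of i] that unfolding maximal_matching_def matching_def by auto
  have Ldisj: "f = f'" if "f \<in> L i" "f' \<in> L i" "v \<in> f" "v \<in> f'" for f f' i v
    using L[of i] that unfolding maximal_matching_def matching_def by blast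
  have SE: "S \<subseteq> E" and Sdisj: "\<And>e e' v. \<lbrakk>e \<in> S; e' \<in> S; v \<in> e; v \<in> e'\<rbrakk> \<Longrightarrow> e = e'"
    using S unfolding matching_def by blast+
  have NE: "N \<subseteq> E" using N LE unfolding matching_def by blast
  have fin: "finite S" "finite N" using SE NE E(1) finite_subset by blast+
  have finAB: "finite (A g)" "finite (B g)" for g using fin unfolding A_def B_def by auto
  have fing: "finite e" if "e \<in> E" for e using E(2)[OF that] card.infinite by fastforce

  have cover: "\<exists>g\<in>N. e \<in> A g \<union> B g" if e: "e \<in> S" for e
  proof -
    have "e \<in> E" using e SE by auto
    then have "e \<noteq> {}" using E(2) by fastforce
    then obtain f where f: "f \<in> L (lv e)" "e \<inter> f \<noteq> {}"
      using maximal_matching_hits[OF L[of "lv e"], of e] \<open>e \<in> E\<close> by blast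
    have lvf: "lv f = lv e" using LE[OF f(1)] by simp
    consider "f \<in> N" | g where "g \<in> N" "f \<inter> g \<noteq> {}" "lv f < lv g"
      using dom[of f] f(1) by blast
    then show ?thesis
    proof cases
      case 1
      then show ?thesis using e f lvf unfolding A_def by auto
    next
      case (2 g)
      then show ?thesis using e f lvf unfolding A_def B_def by (intro bexI[of _ g]) auto
    qed
  qed

  have cardA: "card (A g) \<le> 2" if "g \<in> N" for g
  proof -
    have "g \<in> E" using that NE by auto
    have "card (A g) \<le> card g"
      \<comment> \<open>Relate e to a vertex it shares with g: the edges of a matching cannot share
        that vertex.\<close>
      by (rule card_le_if_inj_on_rel[where r = "\<lambda>e v. v \<in> e"])
         (use fing[OF \<open>g \<in> E\<close>] Sdisj in \<open>auto simp: A_def\<close>)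
    then show ?thesis using E(2)[OF \<open>g \<in> E\<close>] by simp
  qed

  have cardB: "card {e \<in> B g. lv e = i} \<le> 2" if "g \<in> N" for g i
  proof -
    have "g \<in> E" using that NE by auto
    have "card {e \<in> B g. lv e = i} \<le> card g"
    \<comment> \<open>Relate e to a vertex v of g lying on an edge f of \<open>L i\<close> that
      meets e. If e and e' have v in common, they have f in common as \<open>L i\<close> is a
      matching; both avoid v, so both contain the other endpoint of f.\<close>
    proof (rule card_le_if_inj_on_rel[where r = "\<lambda>e v. \<exists>f\<in>L i. e \<inter> f \<noteq> {} \<and> v \<in> f"])
      show "finite g" using fing \<open>g \<in> E\<close> by simp
    next
      fix e assume "e \<in> {e \<in> B g. lv e = i}"
      then show "\<exists>v. v \<in> g \<and> (\<exists>f\<in>L i. e \<inter> f \<noteq> {} \<and> v \<in> f)" unfolding B_def by auto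
    next
      fix e e' v
      assume e: "e \<in> {e \<in> B g. lv e = i}" "e' \<in> {e \<in> B g. lv e = i}" and v: "v \<in> g"
        and "\<exists>f\<in>L i. e \<inter> f \<noteq> {} \<and> v \<in> f" "\<exists>f\<in>L i. e' \<inter> f \<noteq> {} \<and> v \<in> f"
      then obtain f where f: "f \<in> L i" "e \<inter> f \<noteq> {}" "e' \<inter> f \<noteq> {}" "v \<in> f"
        using Ldisj by blast
      have "v \<notin> e" "v \<notin> e'" using e v unfolding B_def by auto
      moreover obtain c where "f = {v, c}"
        using E(2)[OF LE(1)[OF f(1)]] f(4) by (auto simp: card_2_iff)
      ultimately have "c \<in> e" "c \<in> e'" using f by auto
      then show "e = e'" using e Sdisj unfolding B_def by blast
    qed
    then show ?thesis using E(2)[OF \<open>g \<in> E\<close>] by simp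
  qed

  have charge: "(\<Sum>e\<in>A g \<union> B g. \<alpha> powr of_int (lv e)) \<le> 2 * \<alpha> / (\<alpha> - 1) * \<alpha> powr of_int (lv g)"
    if g: "g \<in> N" for g
  proof -
    have "(\<Sum>e\<in>A g. \<alpha> powr of_int (lv e)) \<le> of_nat (card (A g)) * \<alpha> powr of_int (lv g)"
      using alpha by (intro sum_bounded_above) (auto simp: A_def intro!: powr_mono)
    also have "\<dots> \<le> 2 * \<alpha> powr of_int (lv g)"
      using cardA[OF g] by (intro mult_right_mono) auto
    finally have sumA: "(\<Sum>e\<in>A g. \<alpha> powr of_int (lv e)) \<le> 2 * \<alpha> powr of_int (lv g)" .
    have "(\<Sum>e\<in>B g. \<alpha> powr of_int (lv e))
        = (\<Sum>i\<in>lv ` B g. \<Sum>e\<in>{e \<in> B g. lv e = i}. \<alpha> powr of_int (lv e))"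
      by (rule sum.image_gen[OF finAB(2)])
    also have "\<dots> = (\<Sum>i\<in>lv ` B g. of_nat (card {e \<in> B g. lv e = i}) * \<alpha> powr of_int i)"
      by (intro sum.cong refl) simp
    also have "\<dots> \<le> (\<Sum>i\<in>lv ` B g. 2 * \<alpha> powr of_int i)"
      using cardB[OF g] by (intro sum_mono mult_right_mono) auto
    also have "\<dots> = 2 * (\<Sum>i\<in>lv ` B g. \<alpha> powr of_int i)"
      by (simp add: sum_distrib_left)
    also have "\<dots> \<le> 2 * (\<alpha> powr of_int (lv g) / (\<alpha> - 1))"
      using alpha finAB(2) by (intro mult_left_mono sum_powr_below_le) (auto simp: B_def)
    finally have sumB: "(\<Sum>e\<in>B g. \<alpha> powr of_int (lv e)) \<le> 2 * (\<alpha> powr of_int (lv g) / (\<alpha> - 1))" .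
    have "(\<Sum>e\<in>A g \<union> B g. \<alpha> powr of_int (lv e))
        = (\<Sum>e\<in>A g. \<alpha> powr of_int (lv e)) + (\<Sum>e\<in>B g. \<alpha> powr of_int (lv e))"
      by (intro sum.union_disjoint finAB) (auto simp: A_def B_def)
    also have "\<dots> \<le> 2 * \<alpha> powr of_int (lv g) + 2 * (\<alpha> powr of_int (lv g) / (\<alpha> - 1))"
      by (intro add_mono sumA sumB)
    also have "\<dots> = 2 * \<alpha> / (\<alpha> - 1) * \<alpha> powr of_int (lv g)"
      using alpha by (simp add: field_simps)
    finally show ?thesis .
  qed

  have "(\<Sum>e\<in>S. \<alpha> powr of_int (lv e))
      \<le> (\<Sum>(g, e)\<in>Sigma N (\<lambda>g. A g \<union> B g). \<alpha> powr of_int (lv e))"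
    \<comment> \<open>An edge may be charged to several g, so summing over pairs (g, e) gives only
      an upper bound, which suffices.\<close>
    by (rule sum_le_included[where i = snd]) (use fin finAB cover in force)+
  also have "\<dots> = (\<Sum>g\<in>N. \<Sum>e\<in>A g \<union> B g. \<alpha> powr of_int (lv e))"
    using fin finAB by (intro sum.Sigma[symmetric]) auto
  also have "\<dots> \<le> (\<Sum>g\<in>N. 2 * \<alpha> / (\<alpha> - 1) * \<alpha> powr of_int (lv g))"
    by (intro sum_mono charge)
  finally show ?thesis by (simp add: sum_distrib_left)
qed

section \<open>Rounded weights for a fixed shift r\<close>

lemma ugraph_finite_edges: "ugraph V E \<Longrightarrow> finite E"
  unfolding ugraph_def by (rule finite_subset[of _ "Pow V"]) auto

lemma at_level_iff_floor:
  assumes "\<alpha> > 1" "w e > 0"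
  shows "at_level \<alpha> r w e i \<longleftrightarrow> \<lfloor>log \<alpha> (w e) - r\<rfloor> = i"
proof -
  have "at_level \<alpha> r w e i \<longleftrightarrow> of_int i + r \<le> log \<alpha> (w e) \<and> log \<alpha> (w e) < of_int i + r + 1"
    using assms by (simp add: at_level_def powr_le_iff log_less_iff)
  then show ?thesis by (auto simp: floor_eq_iff)
qed

text \<open>All rounded weights carry the same factor \<alpha>^r, which leaves pure level powers for
  the charging bound. Only the side of \<open>N\<close> is then raised from \<open>low\<close> to
  \<open>w\<close>; the side of \<open>S\<close> stays rounded, to be averaged over r later.\<close>

lemma rounded_matching_weight_le:
  fixes \<alpha> r :: real and w :: "'a set \<Rightarrow> real"
  defines "low e \<equiv> \<alpha> powr (of_int \<lfloor>log \<alpha> (w e) - r\<rfloor> + r)"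
  assumes graph: "ugraph V E" and weights: "\<And>e. e \<in> E \<Longrightarrow> w e > 0" and alpha: "\<alpha> > 1"
    and S: "matching E S"
    and L: "\<And>i. maximal_matching (level_edges \<alpha> r w E i) (L i)"
    and N: "level_dominating_matching \<alpha> r w (\<Union>i. L i) N"
  shows "(\<Sum>e\<in>S. low e) \<le> 2 * \<alpha> / (\<alpha> - 1) * (\<Sum>e\<in>N. w e)"
proof -
  define lv where "lv e = \<lfloor>log \<alpha> (w e) - r\<rfloor>" for e
  have lev: "at_level \<alpha> r w e i \<longleftrightarrow> lv e = i" if "e \<in> E" for e i
    using at_level_iff_floor[of \<alpha> w e r i] weights[OF that] alpha by (simp add: lv_def)
  have low: "low e = \<alpha> powr r * \<alpha> powr of_int (lv e)" for e
    by (simp add: low_def lv_def powr_add)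
  have L': "maximal_matching {e \<in> E. lv e = i} (L i)" for i
  proof -
    have "level_edges \<alpha> r w E i = {e \<in> E. lv e = i}"
      using lev by (auto simp: level_edges_def)
    then show ?thesis using L[of i] by simp
  qed
  have LE: "(\<Union>i. L i) \<subseteq> E"
    using L' unfolding maximal_matching_def matching_def by blast
  have N': "matching (\<Union>i. L i) N" using N by (simp add: level_dominating_matching_def)
  then have NE: "N \<subseteq> E" using LE unfolding matching_def by blast
  have E: "finite E" "\<And>e. e \<in> E \<Longrightarrow> card e = 2"
    using graph ugraph_finite_edges by (auto simp: ugraph_def)
  have dom: "f \<in> N \<or> (\<exists>g\<in>N. f \<inter> g \<noteq> {} \<and> lv f < lv g)" if "f \<in> (\<Union>i. L i)" for f
  proof -
    have "f \<in> N \<or> (\<exists>g\<in>N. f \<inter> g \<noteq> {} \<and> (\<exists>i j. at_level \<alpha> r w f i \<and> at_level \<alpha> r w g j \<and> i < j))"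
      using N that unfolding level_dominating_matching_def by blast
    moreover have "f \<in> E" using that LE by blast
    moreover have "g \<in> E" if "g \<in> N" for g using that NE by blast
    ultimately show ?thesis by (auto simp: lev)
  qed
  have "(\<Sum>e\<in>S. low e) = \<alpha> powr r * (\<Sum>e\<in>S. \<alpha> powr of_int (lv e))"
    by (simp add: low sum_distrib_left)
  also have "\<dots> \<le> \<alpha> powr r * (2 * \<alpha> / (\<alpha> - 1) * (\<Sum>e\<in>N. \<alpha> powr of_int (lv e)))"
    by (intro mult_left_mono level_charging[OF alpha E S L' N' dom]) auto
  also have "\<dots> = 2 * \<alpha> / (\<alpha> - 1) * (\<Sum>e\<in>N. low e)"
    by (simp add: low mult_ac flip: sum_distrib_left)
  also have "\<dots> \<le> 2 * \<alpha> / (\<alpha> - 1) * (\<Sum>e\<in>N. w e)"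
  proof (intro mult_left_mono sum_mono)
    fix e assume "e \<in> N"
    then have "at_level \<alpha> r w e (lv e)" using lev[of e "lv e"] NE by auto
    then show "low e \<le> w e" by (simp add: at_level_def low_def lv_def)
  qed (use alpha in auto)
  finally show ?thesis .
qed

section \<open>Expectation of a rounded weight\<close>

abbreviation unit_uniform :: "real measure" where
  "unit_uniform \<equiv> uniform_measure lborel {0<..1}"

lemma unit_uniform_density: "unit_uniform = density lborel (\<lambda>x. ennreal (indicator {0<..1} x))"
  by (simp add: uniform_measure_def divide_ennreal_def ennreal_indicator)

lemma prob_space_unit_uniform: "prob_space unit_uniform"
  by (rule prob_space_uniform_measure) auto

lemma AE_unit_uniform: "AE r in unit_uniform. r \<in> {0<..1}"
  by (rule AE_uniform_measureI) auto

lemma has_bochner_integral_powr: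
  fixes \<alpha> c s t :: real
  assumes "\<alpha> > 1" "s \<le> t"
  shows "has_bochner_integral lborel (\<lambda>r. indicator {s..t} r * \<alpha> powr (c + r))
           ((\<alpha> powr (c + t) - \<alpha> powr (c + s)) / ln \<alpha>)"
proof -
  have "has_bochner_integral lborel (\<lambda>r. indicator {s..t} r *\<^sub>R \<alpha> powr (c + r))
           (\<alpha> powr (c + t) / ln \<alpha> - \<alpha> powr (c + s) / ln \<alpha>)"
    using assms
    by (intro has_bochner_integral_FTC_Icc)
       (auto intro!: derivative_eq_intros continuous_intros
             simp: powr_def has_real_derivative_iff_has_vector_derivative[symmetric])
  then show ?thesis by (simp add: diff_divide_distrib)
qed

text \<open>As r passes the fractional part t of \<open>L\<close>, the floor drops from n to n - 1.
  The exponent thus sweeps [n, L] and then (L - 1, n], and the two integrals add up to that of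
  \<alpha>^x over an interval of length 1 ending at \<open>L\<close>.\<close>

lemma has_bochner_integral_rounded_powr:
  fixes \<alpha> L :: real
  assumes "\<alpha> > 1"
  shows "has_bochner_integral unit_uniform (\<lambda>r. \<alpha> powr (of_int \<lfloor>L - r\<rfloor> + r))
           ((\<alpha> - 1) / (\<alpha> * ln \<alpha>) * \<alpha> powr L)"
proof -
  define n t where "n = \<lfloor>L\<rfloor>" and "t = frac L"
  have t: "0 \<le> t" "t < 1" and L: "L = of_int n + t"
    by (simp_all add: n_def t_def frac_lt_1) (simp add: frac_def)
  \<comment> \<open>Closed intervals suit the fundamental theorem of calculus; the errors at 0 and t
    form a null set.\<close>
  let ?f = "\<lambda>r. indicator {0..t} r * \<alpha> powr (of_int n + r) + indicator {t..1} r * \<alpha> powr (of_int n - 1 + r)"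
  have "has_bochner_integral lborel ?f
      ((\<alpha> powr (of_int n + t) - \<alpha> powr (of_int n + 0)) / ln \<alpha> +
       (\<alpha> powr (of_int n - 1 + 1) - \<alpha> powr (of_int n - 1 + t)) / ln \<alpha>)"
    using assms t by (intro has_bochner_integral_add has_bochner_integral_powr) auto
  also have "(\<alpha> powr (of_int n + t) - \<alpha> powr (of_int n + 0)) / ln \<alpha> +
       (\<alpha> powr (of_int n - 1 + 1) - \<alpha> powr (of_int n - 1 + t)) / ln \<alpha>
     = (\<alpha> powr L - \<alpha> powr (L - 1)) / ln \<alpha>"
    by (simp add: L add_divide_distrib diff_divide_distrib algebra_simps)
  also have "\<dots> = (\<alpha> - 1) / (\<alpha> * ln \<alpha>) * \<alpha> powr L"
    using assms by (simp add: powr_diff field_simps)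
  finally have "has_bochner_integral lborel ?f ((\<alpha> - 1) / (\<alpha> * ln \<alpha>) * \<alpha> powr L)" .
  moreover have "AE r in lborel. ?f r = indicator {0<..1} r *\<^sub>R \<alpha> powr (of_int \<lfloor>L - r\<rfloor> + r)"
    using AE_lborel_singleton[of 0] AE_lborel_singleton[of t]
  proof eventually_elim
    case (elim r)
    have "\<lfloor>L - r\<rfloor> = n" if "r \<le> t" "0 \<le> r"
      using that t unfolding L by (intro floor_unique) auto
    moreover have "\<lfloor>L - r\<rfloor> = n - 1" if "t < r" "r \<le> 1"
      using that t unfolding L by (intro floor_unique) auto
    ultimately show ?case using elim t by (auto simp: indicator_def)
  qed
  ultimately have "has_bochner_integral lborel
      (\<lambda>r. indicator {0<..1} r *\<^sub>R \<alpha> powr (of_int \<lfloor>L - r\<rfloor> + r)) ((\<alpha> - 1) / (\<alpha> * ln \<alpha>) * \<alpha> powr L)"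
    by (subst (asm) has_bochner_integral_cong_AE) auto
  then show ?thesis
    unfolding unit_uniform_density by (intro has_bochner_integral_density) auto
qed

section \<open>Numerical bracketing of the root of 2 * ln a = a - 1\<close>

lemma ln_2_bounds: "0.69314717 \<le> ln (2::real)" "ln (2::real) \<le> 0.6931473"
  using ln_approx_bounds[of 2 7] by (simp_all add: eval_nat_numeral)

lemma ln_8_7_bounds: "0.1335313 \<le> ln (8 / 7 :: real)" "ln (8 / 7 :: real) \<le> 0.1335314"
  using ln_approx_bounds[of "8 / 7" 3] by (simp_all add: eval_nat_numeral)

text \<open>
  Splitting off the factor \<open>7 / 2\<close> leaves arguments so close to \<open>1\<close> that one term of the series
  for \<open>ln\<close> is accurate enough.
\<close>

lemma ln_mult_7_2:
  assumes "x > 0"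
  shows "ln (7 / 2 * x) = 2 * ln 2 - ln (8 / 7) + ln (x::real)"
proof -
  have "ln (7 / 2 * x) = ln (7 / 2) + ln x" using assms by (intro ln_mult_pos) auto
  moreover have "ln (7 / 2) = ln (2\<^sup>2) - ln (8 / 7 :: real)"
    using ln_div[of "2\<^sup>2" "8 / 7 :: real"] by simp
  moreover have "ln (2\<^sup>2) = 2 * ln (2 :: real)" by (subst ln_realpow) auto
  ultimately show ?thesis by linarith
qed

text \<open>Five decimals are needed here: a^2 / (a - 1) exceeds 4.9108 by less than 0.00001 at this
  point, which is the left end of the bracket for the root.\<close>

lemma two_ln_at_351285: "2 * ln (3.51285::real) > 3.51285 - 1"
proof -
  have "ln (3.51285 / 3.5) \<ge> (0.00366470::real)"
    using ln_approx_bounds[of "3.51285 / 3.5" 1] by (simp add: eval_nat_numeral)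
  then show ?thesis
    using ln_2_bounds ln_8_7_bounds ln_mult_7_2[of "3.51285 / 3.5"] by simp
qed

lemma two_ln_at_35129: "2 * ln (3.5129::real) < 3.5129 - 1"
proof -
  have "ln (3.5129 / 3.5) \<le> (0.00367895::real)"
    using ln_approx_bounds[of "3.5129 / 3.5" 1] by (simp add: eval_nat_numeral)
  then show ?thesis
    using ln_2_bounds ln_8_7_bounds ln_mult_7_2[of "3.5129 / 3.5"] by simp
qed

section \<open>Monotonicity of the ratio on either side of the root\<close>

lemma ln_less_minus_one:
  fixes x :: real
  assumes "x > 0" "x \<noteq> 1"
  shows "ln x < x - 1"
  using assms ln_eq_minus_one[of x] ln_le_minus_one[of x] by fastforce

text \<open>The line \<open>x \<mapsto> (x - 1) / 2\<close> is the chord of \<open>ln\<close> between \<open>1\<close> and \<open>a\<close>.\<close>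

lemma ln_above_chord:
  fixes a x :: real
  assumes root: "2 * ln a = a - 1" and "1 < x" "x < a"
  shows "2 * ln x > x - 1"
proof -
  have ax: "a > 0" "x > 0" using assms by auto
  \<comment> \<open>This and the next bound say that the tangent of \<open>ln\<close> at x lies
    above \<open>ln\<close> at a and at 1. The weights x - 1 and a - x make the tangent terms
    cancel.\<close>
  have 1: "ln (a / x) < a / x - 1"
    using ax assms by (intro ln_less_minus_one) auto
  have 2: "ln (1 / x) < 1 / x - 1"
    using ax assms by (intro ln_less_minus_one) auto
  have "(x - 1) * ln (a / x) + (a - x) * ln (1 / x) < (x - 1) * (a / x - 1) + (a - x) * (1 / x - 1)"
    using 1 2 assms by (intro add_strict_mono mult_strict_left_mono) auto
  also have "\<dots> = 0" using ax by (simp add: field_simps)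
  finally have "(x - 1) * (2 * ln a) < (a - 1) * (2 * ln x)"
    using ax by (simp add: ln_div algebra_simps)
  then have "(a - 1) * (x - 1) < (a - 1) * (2 * ln x)"
    unfolding root by (simp add: mult.commute)
  then show ?thesis using assms by simp
qed

lemma ln_below_chord:
  fixes a x :: real
  assumes root: "2 * ln a = a - 1" and "1 < a" "a < x"
  shows "2 * ln x < x - 1"
proof -
  have ax: "a > 0" "x > 0" using assms by auto
  \<comment> \<open>Same argument with the tangent at a, which now lies between 1 and x.\<close>
  have 1: "ln (x / a) < x / a - 1"
    using ax assms by (intro ln_less_minus_one) auto
  have 2: "ln (1 / a) < 1 / a - 1"
    using ax assms by (intro ln_less_minus_one) auto
  have "(a - 1) * ln (x / a) + (x - a) * ln (1 / a) < (a - 1) * (x / a - 1) + (x - a) * (1 / a - 1)"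
    using 1 2 assms by (intro add_strict_mono mult_strict_left_mono) auto
  also have "\<dots> = 0" using ax by (simp add: field_simps)
  finally have "(a - 1) * (2 * ln x) < (x - 1) * (2 * ln a)"
    using ax by (simp add: ln_div algebra_simps)
  then have "(a - 1) * (2 * ln x) < (a - 1) * (x - 1)"
    unfolding root by (simp add: mult.commute)
  then show ?thesis using assms by simp
qed

text \<open>The form of the derivative isolates x - 1 - 2 * ln x, the only factor whose sign varies
  for x > 1.\<close>

lemma scaling_ratio_has_derivative:
  assumes "x > 1"
  shows "(scaling_ratio has_real_derivative 2 * x * (x - 1 - 2 * ln x) / (x - 1) ^ 3) (at x)"
proof -
  have eq: "scaling_ratio = (\<lambda>\<alpha>. 2 * (\<alpha>\<^sup>2 * ln \<alpha>) / (\<alpha> - 1)\<^sup>2)"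
    by (simp add: fun_eq_iff scaling_ratio_def)
  have "((\<lambda>\<alpha>. \<alpha>\<^sup>2 * ln \<alpha>) has_real_derivative (2 * x * ln x + x)) (at x)"
    using assms by (auto intro!: derivative_eq_intros simp: power2_eq_square)
  moreover have "((\<lambda>\<alpha>. (\<alpha> - 1)\<^sup>2) has_real_derivative (2 * (x - 1))) (at x)"
    by (auto intro!: derivative_eq_intros)
  ultimately have "(scaling_ratio has_real_derivative
      (2 * (2 * x * ln x + x) * (x - 1)\<^sup>2 - 2 * (x\<^sup>2 * ln x) * (2 * (x - 1))) / ((x - 1)\<^sup>2 * (x - 1)\<^sup>2)) (at x)"
    unfolding eq using assms by (intro DERIV_divide DERIV_cmult) auto
  also have "2 * (2 * x * ln x + x) * (x - 1)\<^sup>2 - 2 * (x\<^sup>2 * ln x) * (2 * (x - 1))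
      = (x - 1) * (2 * x * (x - 1 - 2 * ln x))"
    by (simp add: power2_eq_square algebra_simps)
  also have "\<dots> / ((x - 1)\<^sup>2 * (x - 1)\<^sup>2) = 2 * x * (x - 1 - 2 * ln x) / (x - 1) ^ 3"
  proof -
    have "(x - 1)\<^sup>2 * (x - 1)\<^sup>2 = (x - 1) * (x - 1) ^ 3"
      by (simp add: power2_eq_square power3_eq_cube)
    then show ?thesis using assms by simp
  qed
  finally show ?thesis .
qed

lemma scaling_ratio_less:
  assumes root: "2 * ln a = a - 1" and "1 < a" "1 < x" "x \<noteq> a"
  shows "scaling_ratio a < scaling_ratio x"
proof (cases "x < a")
  case True
  show ?thesis
  \<comment> \<open>The derivative vanishes at a itself, so its sign is required only on the open
    interval.\<close>
  proof (rule DERIV_neg_imp_decreasing_open[OF True])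
    fix y assume y: "x < y" "y < a"
    have "2 * y * (y - 1 - 2 * ln y) / (y - 1) ^ 3 < 0"
      using ln_above_chord[OF root, of y] y assms
      by (intro divide_neg_pos mult_pos_neg) auto
    then show "\<exists>d. (scaling_ratio has_real_derivative d) (at y) \<and> d < 0"
      using scaling_ratio_has_derivative[of y] y assms by auto
  next
    show "continuous_on {x..a} scaling_ratio"
      using assms
      by (intro continuous_at_imp_continuous_on ballI DERIV_isCont[OF scaling_ratio_has_derivative]) auto
  qed
next
  case False
  then have ax: "a < x" using assms by auto
  show ?thesis
  proof (rule DERIV_pos_imp_increasing_open[OF ax])
    fix y assume y: "a < y" "y < x"
    have "2 * y * (y - 1 - 2 * ln y) / (y - 1) ^ 3 > 0"
      using ln_below_chord[OF root, of y] y assms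
      by (intro divide_pos_pos mult_pos_pos) auto
    then show "\<exists>d. (scaling_ratio has_real_derivative d) (at y) \<and> d > 0"
      using scaling_ratio_has_derivative[of y] y assms by auto
  next
    show "continuous_on {a..x} scaling_ratio"
      using assms
      by (intro continuous_at_imp_continuous_on ballI DERIV_isCont[OF scaling_ratio_has_derivative]) auto
  qed
qed

section \<open>The minimiser and its value\<close>

lemma two_ln_root:
  obtains a :: real where "2 * ln a = a - 1" "3.51285 \<le> a" "a \<le> 3.5129"
proof -
  have "\<exists>a\<ge>3.51285. a \<le> 3.5129 \<and> a - 1 - 2 * ln a = (0::real)"
    using two_ln_at_351285 two_ln_at_35129
    by (intro IVT') (auto intro!: continuous_intros)
  then obtain a :: real where "3.51285 \<le> a" "a \<le> 3.5129" "a - 1 - 2 * ln a = 0"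
    by blast
  then show ?thesis by (intro that[of a]) linarith+
qed

text \<open>Eliminates the logarithm, so that the minimum can be bounded by polynomial
  inequalities.\<close>

lemma scaling_ratio_at_root:
  assumes "2 * ln a = a - 1" "1 < a"
  shows "scaling_ratio a = a\<^sup>2 / (a - 1)"
proof -
  have "scaling_ratio a = a\<^sup>2 * (2 * ln a) / (a - 1)\<^sup>2"
    by (simp add: scaling_ratio_def mult_ac)
  then show ?thesis
    unfolding assms(1) using assms(2) by (simp add: power2_eq_square)
qed

lemma scaling_ratio_minimum:
  obtains a where
    "a \<in> {3.512..<3.513}" "scaling_ratio a \<in> {4.9108..<4.9109}"
    "\<And>b. is_arg_min scaling_ratio (\<lambda>x. x > 1) b \<longleftrightarrow> b = a"
proof -
  obtain a :: real where a: "2 * ln a = a - 1" "3.51285 \<le> a" "a \<le> 3.5129"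
    by (rule two_ln_root)
  \<comment> \<open>Bounds a^2 below by its tangent at the left end of the bracket, which makes the
    goal linear in a.\<close>
  have "(a - 3.51285) * (a - 3.51285) \<ge> 0" by simp
  then have lower: "4.9108 * (a - 1) \<le> a\<^sup>2"
    using a(2,3) by (simp add: power2_eq_square algebra_simps)
  \<comment> \<open>Bounds a^2 above by its chord over the bracket.\<close>
  have "(a - 3.51285) * (3.5129 - a) \<ge> 0" using a by simp
  then have "a * a \<le> (3.51285 + 3.5129) * a - 3.51285 * 3.5129"
    by (simp add: field_simps)
  then have upper: "a\<^sup>2 < 4.9109 * (a - 1)"
    using a(2,3) by (simp add: power2_eq_square)
  have "scaling_ratio a \<in> {4.9108..<4.9109}"
    using scaling_ratio_at_root[OF a(1)] a(2) lower upper
    by (simp add: pos_le_divide_eq pos_divide_less_eq)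
  moreover have "is_arg_min scaling_ratio (\<lambda>x. x > 1) b \<longleftrightarrow> b = a" for b
  proof -
    have "1 < a" using a(2) by simp
    then show ?thesis
      using scaling_ratio_less[OF a(1)] unfolding is_arg_min_def
      by (metis less_asym less_irrefl)
  qed
  ultimately show ?thesis using a(2,3) by (intro that[of a]) simp_all
qed

section \<open>Averaging over the random shift\<close>

theorem theorem3:
  fixes V :: "'a set" and E Mstar :: "'a set set" and w :: "'a set \<Rightarrow> real" and \<alpha> :: real
    and Mlev :: "real \<Rightarrow> int \<Rightarrow> 'a set set" and M :: "real \<Rightarrow> 'a set set"
  assumes graph: "ugraph V E"
    and weights: "\<forall>e\<in>E. w e > 0"
    and Mstar: "max_weight_matching w E Mstar"
    and alpha: "\<alpha> > 1"
    and Mlev: "\<forall>r\<in>{0<..1}. \<forall>i. maximal_matching (level_edges \<alpha> r w E i) (Mlev r i)"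
    and M: "\<forall>r\<in>{0<..1}. level_dominating_matching \<alpha> r w (\<Union>i. Mlev r i) (M r)"
    and meas: "(\<lambda>r. \<Sum>e\<in>M r. w e) \<in> borel_measurable (uniform_measure lborel {0<..1})"
  shows "prob_space.expectation (uniform_measure lborel {0<..1}) (\<lambda>r. \<Sum>e\<in>M r. w e)
           \<ge> (\<alpha> - 1)\<^sup>2 / (2 * \<alpha>\<^sup>2 * ln \<alpha>) * (\<Sum>e\<in>Mstar. w e)
       \<and> (\<Sum>e\<in>Mstar. w e)
           \<le> scaling_ratio \<alpha>
              * prob_space.expectation (uniform_measure lborel {0<..1}) (\<lambda>r. \<Sum>e\<in>M r. w e)
       \<and> (\<exists>a. is_arg_min scaling_ratio (\<lambda>x. x > 1) a)
       \<and> (\<forall>a. is_arg_min scaling_ratio (\<lambda>x. x > 1) a \<longrightarrow>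
             a \<in> {3.512..<3.513} \<and> scaling_ratio a \<in> {4.9108..<4.9109})"
proof -
  interpret prob_space unit_uniform by (rule prob_space_unit_uniform)
  let ?X = "\<lambda>r. \<Sum>e\<in>M r. w e"
  let ?low = "\<lambda>e r. \<alpha> powr (of_int \<lfloor>log \<alpha> (w e) - r\<rfloor> + r)"
  have S: "matching E Mstar" using Mstar by (simp add: max_weight_matching_def)
  have finE: "finite E" using graph by (rule ugraph_finite_edges)
  have sub: "M r \<subseteq> E" if "r \<in> {0<..1}" for r
  proof -
    have "M r \<subseteq> (\<Union>i. Mlev r i)"
      using M that by (simp add: level_dominating_matching_def matching_def)
    moreover have "Mlev r i \<subseteq> level_edges \<alpha> r w E i" for i
      using Mlev that unfolding maximal_matching_def matching_def by blast
    moreover have "level_edges \<alpha> r w E i \<subseteq> E" for i by (auto simp: level_edges_def)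
    ultimately show ?thesis by blast
  qed

  \<comment> \<open>The Bochner integral of a non-integrable function defaults to 0, so
    integrability is established first: almost surely the weight lies between 0 and the total weight
    of \<open>E\<close>.\<close>
  have int_X: "integrable unit_uniform ?X"
  proof (rule integrable_const_bound[OF _ meas])
    show "AE r in unit_uniform. norm (?X r) \<le> (\<Sum>e\<in>E. w e)"
      using AE_unit_uniform
    proof eventually_elim
      case (elim r)
      have "?X r \<le> (\<Sum>e\<in>E. w e)"
        using sub[OF elim] weights finE by (intro sum_mono2) (auto intro: less_imp_le)
      moreover have "?X r \<ge> 0"
        using sub[OF elim] weights by (intro sum_nonneg) (auto intro: less_imp_le)
      ultimately show ?case by simp
    qed
  qed

  have "has_bochner_integral unit_uniform (\<lambda>r. \<Sum>e\<in>Mstar. ?low e r)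
          (\<Sum>e\<in>Mstar. (\<alpha> - 1) / (\<alpha> * ln \<alpha>) * \<alpha> powr (log \<alpha> (w e)))"
    by (intro has_bochner_integral_sum has_bochner_integral_rounded_powr alpha)
  also have "(\<Sum>e\<in>Mstar. (\<alpha> - 1) / (\<alpha> * ln \<alpha>) * \<alpha> powr (log \<alpha> (w e)))
      = (\<alpha> - 1) / (\<alpha> * ln \<alpha>) * (\<Sum>e\<in>Mstar. w e)"
    unfolding sum_distrib_left using S weights alpha
    by (intro sum.cong refl arg_cong2[where f = "(*)"] powr_log_cancel) (auto simp: matching_def)
  finally have low: "has_bochner_integral unit_uniform (\<lambda>r. \<Sum>e\<in>Mstar. ?low e r)
      ((\<alpha> - 1) / (\<alpha> * ln \<alpha>) * (\<Sum>e\<in>Mstar. w e))" .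

  have "(\<alpha> - 1) / (\<alpha> * ln \<alpha>) * (\<Sum>e\<in>Mstar. w e) = expectation (\<lambda>r. \<Sum>e\<in>Mstar. ?low e r)"
    using low by (simp add: has_bochner_integral_iff)
  also have "\<dots> \<le> expectation (\<lambda>r. 2 * \<alpha> / (\<alpha> - 1) * ?X r)"
  proof (rule integral_mono_AE)
    show "AE r in unit_uniform. (\<Sum>e\<in>Mstar. ?low e r) \<le> 2 * \<alpha> / (\<alpha> - 1) * ?X r"
      using AE_unit_uniform
    proof eventually_elim
      case (elim r)
      then show ?case
        using Mlev M weights
        by (intro rounded_matching_weight_le[OF graph _ alpha S, of w r "Mlev r"]) auto
    qed
  qed (use low int_X in \<open>auto simp: has_bochner_integral_iff\<close>)
  finally have main: "(\<alpha> - 1) / (\<alpha> * ln \<alpha>) * (\<Sum>e\<in>Mstar. w e) \<le> 2 * \<alpha> / (\<alpha> - 1) * expectation ?X"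
    by simp

  define W X where "W = (\<Sum>e\<in>Mstar. w e)" and "X = expectation ?X"
  have pos: "ln \<alpha> > 0" "\<alpha> - 1 > 0" "\<alpha> > 0" using alpha by auto
  \<comment> \<open>The constant is the rounding loss (\<alpha> - 1) / (\<alpha> * ln \<alpha>)
    times the inverse of the charging factor 2 * \<alpha> / (\<alpha> - 1).\<close>
  have "(\<alpha> - 1)\<^sup>2 / (2 * \<alpha>\<^sup>2 * ln \<alpha>) * W
      = (\<alpha> - 1) / (2 * \<alpha>) * ((\<alpha> - 1) / (\<alpha> * ln \<alpha>) * W)"
    by (simp add: power2_eq_square mult_ac)
  also have "\<dots> \<le> (\<alpha> - 1) / (2 * \<alpha>) * (2 * \<alpha> / (\<alpha> - 1) * X)"
    using main pos unfolding W_def X_def by (intro mult_left_mono) auto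
  also have "\<dots> = X" using pos by simp
  finally have lower: "(\<alpha> - 1)\<^sup>2 / (2 * \<alpha>\<^sup>2 * ln \<alpha>) * W \<le> X" .
  have "W = scaling_ratio \<alpha> * ((\<alpha> - 1)\<^sup>2 / (2 * \<alpha>\<^sup>2 * ln \<alpha>) * W)"
    using pos by (simp add: scaling_ratio_def)
  also have "\<dots> \<le> scaling_ratio \<alpha> * X"
    using pos by (intro mult_left_mono lower) (auto simp: scaling_ratio_def)
  finally have upper: "W \<le> scaling_ratio \<alpha> * X" .
  obtain a where a: "a \<in> {3.512..<3.513}" "scaling_ratio a \<in> {4.9108..<4.9109}"
    and arg_min: "\<And>b. is_arg_min scaling_ratio (\<lambda>x. x > 1) b \<longleftrightarrow> b = a"
    by (rule scaling_ratio_minimum) blast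
  show ?thesis
    unfolding arg_min using a lower upper unfolding W_def X_def
    by (intro conjI exI[of _ a] allI impI) simp_all
qed

end
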